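(* Let $n, r, d \ge 0$ be integers and let $\Gamma \subset \mathbb{P}^n$ be a finite set of points satisfying $\mathrm{CB}(r)$ and $|\Gamma| \le (d+1)r+1$. Then the following hold. (i) If $r \le 2$ (and $d$ is arbitrary), then $\Gamma$ lies on a plane configuration $\mathcal{P}$ of dimension at most $d$. Moreover, $\mathcal{P}$ may be taken with length $\ell(\mathcal{P}) \le 1$ (that is, a single linear space, or the empty configuration in the degenerate case where $\Gamma$ is empty). (ii) If $d \le 3$ (and $r$ is arbitrary), then $\Gamma$ lies on a plane configuration $\mathcal{P}$ of dimension at most $d$. Moreover, if in addition $r \le 4$, then $\mathcal{P}$ may be taken with $\ell(\mathcal{P}) \le 2$. (iii) If $d = 4$ and $r = 3$, then $\Gamma$ lies on a plane configuration $\mathcal{P}$ of dimension at most $4$. Moreover, $\mathcal{P}$ may be taken with $\ell(\mathcal{P}) \le 2$.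
   Context: $\mathbb{P}^n$ is projective space over an algebraically closed field. A finite set $\Gamma \subset \mathbb{P}^n$ satisfies $\mathrm{CB}(r)$ (the Cayley--Bacharach condition with respect to degree $r$ polynomials) if, whenever a homogeneous polynomial $F$ of degree $r$ vanishes at all but one point of $\Gamma$, $F$ also vanishes at the last point. (The empty set is vacuously $\mathrm{CB}(r)$.) A plane configuration $\mathcal{P} = P_1 \cup \cdots \cup P_k \subseteq \mathbb{P}^n$ is a union of finitely many distinct positive-dimensional linear subspaces; its dimension is $\dim \mathcal{P} = \sum_i \dim P_i$ and its length is $\ell(\mathcal{P}) = k$. The $0$-dimensional plane configuration is empty (length $0$). "$\Gamma$ lies on $\mathcal{P}$" means $\Gamma \subseteq \bigcup_i P_i$. *)

theory Defs
  imports
    "HOL-Analysis.Cartesian_Space"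
    "HOL-Library.Poly_Mapping"
    "HOL-Computational_Algebra.Computational_Algebra"
begin

text \<open>
  Projective space of dimension \<open>CARD('v) - 1\<close> over \<open>'a\<close> is the set of lines through the
  origin of \<open>'a ^ 'v\<close>; subsets of it are sets of such lines.
\<close>

definition proj_space :: "('a::field ^ 'v::finite) set set" where
  "proj_space = {L. vec.subspace L \<and> vec.dim L = 1}"

definition proj_of :: "('a::field ^ 'v::finite) set \<Rightarrow> ('a ^ 'v) set set" where
  "proj_of W = {L \<in> proj_space. L \<subseteq> W}"

definition linear_subspace :: "('a::field ^ 'v::finite) set set \<Rightarrow> bool" where
  "linear_subspace P \<longleftrightarrow> (\<exists>W. vec.subspace W \<and> P = proj_of W)"

text \<open>
  \<open>vec.dim\<close> of an arbitrary set is the dimension of its span. As the subtraction is truncated,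
  the empty linear subspace gets the value 0 here rather than \<open>-1\<close>.
\<close>

definition proj_dim :: "('a::field ^ 'v::finite) set set \<Rightarrow> nat" where
  "proj_dim P = vec.dim (\<Union>P) - 1"

lemma Union_proj_of:
  assumes "vec.subspace W"
  shows "\<Union>(proj_of W) - {0} = W - {0}"
proof
  show "\<Union>(proj_of W) - {0} \<subseteq> W - {0}" by (auto simp: proj_of_def)
  show "W - {0} \<subseteq> \<Union>(proj_of W) - {0}"
  proof
    fix x assume x: "x \<in> W - {0}"
    have "vec.span {x} \<subseteq> W" using x assms by (simp add: vec.span_minimal)
    moreover have "vec.dim (vec.span {x}) = 1"
      using x vec.dim_eq_card_independent[of "{x}"] by (simp add: vec.dim_span)
    ultimately have "vec.span {x} \<in> proj_of W"
      by (simp add: proj_of_def proj_space_def)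
    then show "x \<in> \<Union>(proj_of W) - {0}" using x vec.span_base[of x "{x}"] by auto
  qed
qed

lemma proj_dim_proj_of:
  assumes "vec.subspace W"
  shows "proj_dim (proj_of W) = vec.dim W - 1"
proof -
  have "vec.span (\<Union>(proj_of W)) = vec.span W"
    using Union_proj_of[OF assms] vec.span_delete_0 by metis
  then show ?thesis unfolding proj_dim_def using vec.dim_span by metis
qed

text \<open>
  A polynomial in the homogeneous coordinates is a finitely supported function from exponent
  vectors \<open>'v \<Rightarrow>\<^sub>0 nat\<close> to coefficients. The zero polynomial is homogeneous of every degree.
\<close>

type_synonym ('v, 'a) mpolynomial = "('v \<Rightarrow>\<^sub>0 nat) \<Rightarrow>\<^sub>0 'a"

definition eval_poly :: "('v::finite, 'a::field) mpolynomial \<Rightarrow> 'a ^ 'v \<Rightarrow> 'a" where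
  "eval_poly F x =
    (\<Sum>m\<in>Poly_Mapping.keys F.
      Poly_Mapping.lookup F m * (\<Prod>i\<in>UNIV. (x $ i) ^ Poly_Mapping.lookup m i))"

definition homogeneous :: "nat \<Rightarrow> ('v::finite, 'a::field) mpolynomial \<Rightarrow> bool" where
  "homogeneous r F \<longleftrightarrow>
    (\<forall>m\<in>Poly_Mapping.keys F. (\<Sum>i\<in>UNIV. Poly_Mapping.lookup m i) = r)"

definition vanishes_at :: "('v::finite, 'a::field) mpolynomial \<Rightarrow> ('a ^ 'v) set \<Rightarrow> bool" where
  "vanishes_at F p \<longleftrightarrow> (\<forall>x\<in>p - {0}. eval_poly F x = 0)"

definition CB :: "nat \<Rightarrow> ('a::field ^ 'v::finite) set set \<Rightarrow> bool" where
  "CB r \<Gamma> \<longleftrightarrow>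
    (\<forall>F p. homogeneous r F \<longrightarrow> p \<in> \<Gamma> \<longrightarrow> (\<forall>q\<in>\<Gamma> - {p}. vanishes_at F q) \<longrightarrow> vanishes_at F p)"

text \<open>A plane configuration is represented by the set of its constituent subspaces.\<close>

definition plane_config :: "('a::field ^ 'v::finite) set set set \<Rightarrow> bool" where
  "plane_config \<P> \<longleftrightarrow> finite \<P> \<and> (\<forall>P\<in>\<P>. linear_subspace P \<and> proj_dim P > 0)"

definition config_dim :: "('a::field ^ 'v::finite) set set set \<Rightarrow> nat" where
  "config_dim \<P> = (\<Sum>P\<in>\<P>. proj_dim P)"

definition config_length :: "('a::field ^ 'v::finite) set set set \<Rightarrow> nat" where
  "config_length \<P> = card \<P>"

definition lies_on :: "('a::field ^ 'v::finite) set set \<Rightarrow> ('a ^ 'v) set set set \<Rightarrow> bool" where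
  "lies_on \<Gamma> \<P> \<longleftrightarrow> \<Gamma> \<subseteq> \<Union>\<P>"

end

theory Submission
  imports Defs
begin

text \<open>
  The Cayley-Bacharach condition is used through products of linear forms only. If \<open>p\<close> is a point
  of a set \<open>\<Gamma>\<close> with \<open>CB r\<close>, then \<open>r\<close> linear subspaces that avoid \<open>p\<close> cannot contain all the other
  points. By Edmonds' matroid partition theorem (\<open>partition_independent_modulo\<close>), such subspaces
  exist unless some subspace contains too many points for its dimension. Consequently every point
  of \<open>\<Gamma>\<close> lies on a linear space of some dimension \<open>k > 0\<close> with at least \<open>r k + 2\<close> points of \<open>\<Gamma>\<close>;
  such a space is called dense here (\<open>CB_dense_subspace\<close>). There is also a version modulo a given subspace
  (\<open>CB_dense_subspace_modulo\<close>).

  On the other hand, the points of \<open>\<Gamma>\<close> off a linear subspace satisfy \<open>CB (r - 1)\<close> (\<open>CB_excise\<close>).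
  Excising a dense subspace therefore leaves a smaller set of the same kind, and repeating this
  builds up a plane configuration. Excising spaces of dimensions \<open>k\<^sub>1, k\<^sub>2, \<dots>\<close> takes away at least
  \<open>r k\<^sub>1 + 2\<close>, \<open>(r - 1) k\<^sub>2 + 2\<close>, and so on. When the dimensions sum to \<open>d + 1\<close>, this total mostly
  exceeds \<open>(d + 1) r + 1\<close>, so the total dimension stays at most \<open>d\<close>.

  For \<open>r \<le> 2\<close> the version modulo a subspace yields an increasing chain of subspaces in which the
  number of points keeps pace with the dimension, so that a single subspace suffices. For larger
  \<open>r\<close> the count falls short if a large subspace is excised after a smaller one, as for a line
  followed by a solid. This is avoided by excising large dense subspaces first. If there are none,
  every point lies on a line with \<open>r + 2\<close> points, and these lines are disjoint on \<open>\<Gamma>\<close>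
  (\<open>CB_lines\<close>). In the case \<open>d = 4\<close>, \<open>r = 3\<close> planes with eight points are a further
  obstacle, and their incidences are studied separately (\<open>CB_3_planes_share_line\<close>,
  \<open>CB_3_rich_plane_unique\<close>).
\<close>

section \<open>Products of forms\<close>

lemma eval_poly_add: "eval_poly (F + G) x = eval_poly F x + eval_poly G x"
  unfolding eval_poly_def
  by (rule Poly_Mapping.setsum_keys_plus_distrib) (auto simp: distrib_right)

lemma eval_poly_sum: "eval_poly (\<Sum>i\<in>A. F i) x = (\<Sum>i\<in>A. eval_poly (F i) x)"
proof (induction A rule: infinite_finite_induct)
  case (insert i A)
  then show ?case by (simp add: eval_poly_add)
qed (simp_all add: eval_poly_def)

lemma eval_poly_single:
  "eval_poly (Poly_Mapping.single m c) x = c * (\<Prod>i\<in>UNIV. (x $ i) ^ Poly_Mapping.lookup m i)"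
  by (simp add: eval_poly_def)

lemma poly_mapping_sum_single:
  "F = (\<Sum>m\<in>Poly_Mapping.keys F. Poly_Mapping.single m (Poly_Mapping.lookup F m))"
  by (rule poly_mapping_eqI)
     (simp add: lookup_sum lookup_single when_def sum.delta' in_keys_iff)

lemma eval_poly_mult: "eval_poly (F * G) x = eval_poly F x * eval_poly G x"
proof -
  define X where "X m = (\<Prod>i\<in>UNIV. (x $ i) ^ Poly_Mapping.lookup m i)" for m
  have X: "X (m + n) = X m * X n" for m n
    by (simp add: X_def lookup_add power_add prod.distrib)
  let ?f = "Poly_Mapping.lookup F" and ?g = "Poly_Mapping.lookup G"
  have "F * G = (\<Sum>m\<in>Poly_Mapping.keys F. Poly_Mapping.single m (?f m)) *
      (\<Sum>n\<in>Poly_Mapping.keys G. Poly_Mapping.single n (?g n))"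
    using poly_mapping_sum_single[of F] poly_mapping_sum_single[of G] by simp
  also have "\<dots> = (\<Sum>m\<in>Poly_Mapping.keys F. \<Sum>n\<in>Poly_Mapping.keys G.
      Poly_Mapping.single (m + n) (?f m * ?g n))"
    by (simp add: sum_product mult_single)
  finally have "eval_poly (F * G) x =
      (\<Sum>m\<in>Poly_Mapping.keys F. \<Sum>n\<in>Poly_Mapping.keys G. (?f m * X m) * (?g n * X n))"
    by (simp add: eval_poly_sum eval_poly_single X mult_ac flip: X_def)
  also have "\<dots> = eval_poly F x * eval_poly G x"
    by (simp add: eval_poly_def sum_product flip: X_def)
  finally show ?thesis .
qed

lemma homogeneous_mult:
  assumes "homogeneous r F" "homogeneous s G"
  shows "homogeneous (r + s) (F * G)"
  unfolding homogeneous_def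
proof
  fix m assume "m \<in> Poly_Mapping.keys (F * G)"
  then obtain a b where "m = a + b" "a \<in> Poly_Mapping.keys F" "b \<in> Poly_Mapping.keys G"
    using Poly_Mapping.keys_mult by blast
  then show "(\<Sum>i\<in>UNIV. Poly_Mapping.lookup m i) = r + s"
    using assms by (simp add: homogeneous_def lookup_add sum.distrib)
qed

definition linear_form :: "'a ^ 'v \<Rightarrow> ('v::finite, 'a::field) mpolynomial" where
  "linear_form c = (\<Sum>i\<in>UNIV. Poly_Mapping.single (Poly_Mapping.single i 1) (c $ i))"

lemma eval_linear_form: "eval_poly (linear_form c) x = (\<Sum>i\<in>UNIV. c $ i * x $ i)"
proof -
  have "(\<Prod>j\<in>UNIV. (x $ j) ^ Poly_Mapping.lookup (Poly_Mapping.single i 1) j) = x $ i" for i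
  proof -
    have "(\<Prod>j\<in>UNIV. (x $ j) ^ Poly_Mapping.lookup (Poly_Mapping.single i 1) j)
        = (\<Prod>j\<in>UNIV. if j = i then x $ j else 1)"
      by (rule prod.cong) (auto simp: lookup_single when_def)
    then show ?thesis by simp
  qed
  then show ?thesis by (simp add: linear_form_def eval_poly_sum eval_poly_single)
qed

lemma homogeneous_linear_form: "homogeneous 1 (linear_form c)"
  unfolding homogeneous_def
proof
  fix m assume "m \<in> Poly_Mapping.keys (linear_form c)"
  then obtain i where "m = Poly_Mapping.single i 1"
    using keys_sum[of "\<lambda>i. Poly_Mapping.single (Poly_Mapping.single i (1::nat)) (c $ i)" UNIV]
    by (fastforce simp: linear_form_def split: if_splits)
  then show "(\<Sum>i\<in>UNIV. Poly_Mapping.lookup m i) = 1"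
    by (simp add: lookup_single when_def)
qed

text \<open>
  Extend a basis of \<open>U\<close> by \<open>v\<close> and take the linear map that kills \<open>U\<close> and fixes \<open>v\<close>. Any
  coordinate in which \<open>v\<close> is nonzero then gives the form.
\<close>

lemma separating_linear_form:
  fixes U :: "('a::field ^ 'v::finite) set"
  assumes U: "vec.subspace U" and v: "v \<notin> U"
  obtains c where "\<And>x. x \<in> U \<Longrightarrow> eval_poly (linear_form c) x = 0"
    and "eval_poly (linear_form c) v \<noteq> 0"
proof -
  obtain B where B: "B \<subseteq> U" "vec.independent B" "U \<subseteq> vec.span B"
    using vec.basis_exists by metis
  have UB: "vec.span B = U" using B U by (simp add: vec.span_minimal subset_antisym)
  have "vec.independent (insert v B)"
    using B v UB by (simp add: vec.independent_insert)
  then obtain g where g: "Vector_Spaces.linear (*s) (*s) g"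
      "\<forall>x\<in>insert v B. g x = (if x = v then v else 0)"
    using vec.linear_independent_extend[of "insert v B" "\<lambda>x. if x = v then v else 0"] by metis
  have "v \<noteq> 0" using v U vec.subspace_0 by blast
  then obtain j where j: "v $ j \<noteq> 0" by (auto simp: vec_eq_iff)
  have eval: "eval_poly (linear_form (matrix g $ j)) x = g x $ j" for x
    using matrix_works[OF g(1), of x]
    by (simp add: eval_linear_form matrix_vector_mult_def vec_eq_iff)
  interpret g: Vector_Spaces.linear "(*s)" "(*s)" g by (fact g(1))
  have "g b = 0" if "b \<in> B" for b using that g(2) B(1) v by auto
  then have "g x = 0" if "x \<in> U" for x
    using g.eq_0_on_span[of B x] that UB by simp
  moreover have "g v = v" using g(2) by simp
  ultimately show ?thesis
    using that[of "matrix g $ j"] j by (simp add: eval)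
qed

section \<open>Points and linear subspaces\<close>

lemma proj_space_span:
  assumes "p \<in> proj_space" "v \<in> p" "v \<noteq> 0"
  shows "p = vec.span {v}"
  using assms vec.subspace_dim_equal[of "vec.span {v}" p]
  by (simp add: proj_space_def vec.span_minimal)

lemma proj_space_nonzero:
  assumes "p \<in> proj_space"
  obtains v where "v \<in> p" "v \<noteq> 0"
proof -
  have "p \<noteq> {0}" using assms by (auto simp: proj_space_def)
  moreover have "0 \<in> p" using assms by (simp add: proj_space_def vec.subspace_0)
  ultimately show ?thesis using that by blast
qed

lemma mem_proj_of_iff:
  assumes "p \<in> proj_space" "v \<in> p" "v \<noteq> 0" "vec.subspace U"
  shows "p \<in> proj_of U \<longleftrightarrow> v \<in> U"
proof
  show "v \<in> U \<Longrightarrow> p \<in> proj_of U"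
    using assms(1,4) proj_space_span[OF assms(1-3)] vec.span_minimal[of "{v}" U]
    by (simp add: proj_of_def)
qed (use assms(2) in \<open>auto simp: proj_of_def\<close>)

lemma proj_of_Int: "proj_of (U \<inter> V) = proj_of U \<inter> proj_of V"
  by (auto simp: proj_of_def)

lemma proj_of_mono: "U \<subseteq> V \<Longrightarrow> proj_of U \<subseteq> proj_of V"
  by (auto simp: proj_of_def)

lemma dim_ge_2:
  assumes "p \<in> proj_of U" "q \<in> proj_of U" "p \<noteq> q" "vec.subspace U"
  shows "2 \<le> vec.dim U"
proof (rule ccontr)
  assume "\<not> 2 \<le> vec.dim U"
  then have "p = U" "q = U"
    using assms vec.subspace_dim_equal[of p U] vec.subspace_dim_equal[of q U]
    by (auto simp: proj_of_def proj_space_def)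
  then show False using assms(3) by simp
qed

lemma card_Int_proj_of_le_1:
  assumes "vec.subspace U" "vec.dim U < 2"
  shows "card (A \<inter> proj_of U) \<le> 1"
proof (cases "finite (A \<inter> proj_of U)")
  case True
  have "p = q" if "p \<in> A \<inter> proj_of U" "q \<in> A \<inter> proj_of U" for p q
    using that dim_ge_2[of p U q] assms by auto
  then show ?thesis using True by (simp add: card_le_Suc0_iff_eq)
qed simp

lemma dim_span_Un:
  fixes U :: "('a::field ^ 'v::finite) set"
  assumes "vec.subspace U" "vec.subspace V"
  shows "vec.dim (vec.span (U \<union> V)) + vec.dim (U \<inter> V) = vec.dim U + vec.dim V"
proof -
  have "vec.span U = U" "vec.span V = V" using assms by (simp_all add: vec.span_eq_iff)
  then have "vec.span (U \<union> V) = {x + y |x y. x \<in> U \<and> y \<in> V}"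
    by (simp only: vec.span_Un)
  then show ?thesis using vec.dim_sums_Int[OF assms] by simp
qed

section \<open>Excision\<close>

text \<open>
  If a form of degree \<open>r\<close> vanishes on all of \<open>\<Gamma>\<close> outside \<open>U\<close> except at \<open>p\<close>, multiply it by a
  linear form that vanishes on \<open>U\<close> but not at \<open>p\<close>. So every subspace that is removed costs one
  degree, whatever its dimension.
\<close>

lemma CB_excise:
  assumes CB: "CB (Suc r) \<Gamma>" and \<Gamma>: "\<Gamma> \<subseteq> proj_space" and U: "vec.subspace U"
  shows "CB r (\<Gamma> - proj_of U)"
  unfolding CB_def
proof (intro allI impI)
  fix F p
  assume F: "homogeneous r F" and p: "p \<in> \<Gamma> - proj_of U"
    and van: "\<forall>q\<in>\<Gamma> - proj_of U - {p}. vanishes_at F q"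
  have pp: "p \<in> proj_space" using p \<Gamma> by auto
  obtain v where v: "v \<in> p" "v \<noteq> 0" using proj_space_nonzero[OF pp] .
  have "v \<notin> U" using p mem_proj_of_iff[OF pp v U] by simp
  then obtain c where c: "\<And>x. x \<in> U \<Longrightarrow> eval_poly (linear_form c) x = 0"
      "eval_poly (linear_form c) v \<noteq> 0"
    using separating_linear_form[OF U] by blast
  have "vanishes_at (F * linear_form c) q" if "q \<in> \<Gamma> - {p}" for q
  proof (cases "q \<in> proj_of U")
    case True
    then show ?thesis using c(1) by (auto simp: vanishes_at_def eval_poly_mult proj_of_def)
  next
    case False
    then show ?thesis using van that by (auto simp: vanishes_at_def eval_poly_mult)
  qed
  moreover have "homogeneous (Suc r) (F * linear_form c)"
    using homogeneous_mult[OF F homogeneous_linear_form[of c]] by simp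
  ultimately have van_p: "vanishes_at (F * linear_form c) p"
    using CB p unfolding CB_def by blast
  show "vanishes_at F p"
    unfolding vanishes_at_def
  proof
    fix x assume x: "x \<in> p - {0}"
    obtain k where k: "v = k *s x"
      using v(1) x proj_space_span[OF pp, of x] vec.span_singleton[of x] by auto
    have "eval_poly (linear_form c) v = k * eval_poly (linear_form c) x"
      by (simp add: eval_linear_form k sum_distrib_left mult_ac)
    then have "eval_poly (linear_form c) x \<noteq> 0" using c(2) by auto
    then show "eval_poly F x = 0"
      using van_p x by (auto simp: vanishes_at_def eval_poly_mult)
  qed
qed

lemma not_CB_singleton:
  assumes "p \<in> proj_space"
  shows "\<not> CB r {p}"
proof
  assume CB: "CB r {p}"
  obtain v where v: "v \<in> p" "v \<noteq> 0" using proj_space_nonzero[OF assms] .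
  obtain j where j: "v $ j \<noteq> 0" using v(2) by (auto simp: vec_eq_iff)
  define m where "m = Poly_Mapping.single j r"
  have "homogeneous r (Poly_Mapping.single m (1::'a))"
    by (simp add: homogeneous_def m_def lookup_single when_def)
  then have "eval_poly (Poly_Mapping.single m 1) v = 0"
    using CB v unfolding CB_def vanishes_at_def by blast
  moreover have "(\<Prod>i\<in>UNIV. (v $ i) ^ Poly_Mapping.lookup m i) = (v $ j) ^ r"
  proof -
    have "(\<Prod>i\<in>UNIV. (v $ i) ^ Poly_Mapping.lookup m i)
        = (\<Prod>i\<in>UNIV. if i = j then (v $ i) ^ r else 1)"
      by (rule prod.cong) (auto simp: m_def lookup_single when_def)
    then show ?thesis by simp
  qed
  ultimately show False using j by (simp add: eval_poly_single)
qed

text \<open>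
  The product of \<open>r\<close> linear forms, one for each subspace, would contradict the Cayley-Bacharach
  condition at \<open>p\<close>. Excising the subspaces one at a time leaves a set that is \<open>CB 0\<close>, and such a
  set is never a single point.
\<close>

lemma CB_not_covered_by_avoiding_subspaces:
  assumes "CB r \<Gamma>" "\<Gamma> \<subseteq> proj_space" "p \<in> \<Gamma>"
    and "\<And>i. i < r \<Longrightarrow> vec.subspace (U i)" "\<And>i. i < r \<Longrightarrow> p \<notin> proj_of (U i)"
  shows "\<exists>q\<in>\<Gamma> - {p}. \<forall>i<r. q \<notin> proj_of (U i)"
  using assms
proof (induction r arbitrary: \<Gamma>)
  case 0
  then have "\<Gamma> \<noteq> {p}" using not_CB_singleton[of p 0] by auto
  then show ?case using 0 by auto
next
  case (Suc r)
  have "CB r (\<Gamma> - proj_of (U r))" using Suc.prems CB_excise by blast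
  then obtain q where "q \<in> \<Gamma> - proj_of (U r) - {p}" "\<forall>i<r. q \<notin> proj_of (U i)"
    using Suc.IH[of "\<Gamma> - proj_of (U r)"] Suc.prems by auto
  then show ?case by (auto simp: less_Suc_eq intro!: bexI[of _ q])
qed

section \<open>Partitioning vectors into families independent modulo given subspaces\<close>

text \<open>
  Diminishing returns: independence modulo a larger subspace carries over to a smaller one. This is
  what allows classes that were built in successive quotients to be merged.
\<close>

lemma dim_Un_submodular:
  fixes S T :: "('a::field ^ 'v::finite) set"
  assumes "finite B" "vec.span S \<subseteq> vec.span T"
  shows "vec.dim (T \<union> B) + vec.dim S \<le> vec.dim (S \<union> B) + vec.dim T"
  using assms(1)
proof (induction B)
  case (insert b B)
  have "vec.span (S \<union> B) \<subseteq> vec.span (T \<union> B)"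
    using assms(2) by (intro vec.span_minimal) (auto intro: vec.span_base vec.span_mono[THEN subsetD])
  then show ?case using insert.IH by (auto simp: vec.dim_insert)
qed simp

text \<open>
  This is Edmonds' matroid partition theorem for the linear matroids \<open>E\<close> modulo \<open>W i\<close>, or the
  Rado-Horn theorem when all \<open>W i\<close> are trivial. Letting the subspaces differ is what makes a short
  induction on \<open>E\<close> possible. If the rank inequality is an equality for some proper nonempty \<open>X\<close>,
  partition \<open>X\<close> and then \<open>E - X\<close> modulo the spans \<open>W i + X\<close>, for which the inequality still holds.
  If all these inequalities are strict, an element \<open>e\<close> can be put into any class \<open>j\<close> where it is not
  zero modulo \<open>W j\<close>. Enlarging \<open>W j\<close> by \<open>e\<close> uses up at most the slack of one.
\<close>

lemma partition_independent_modulo: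
  fixes v :: "'b \<Rightarrow> 'a::field ^ 'v::finite" and W :: "nat \<Rightarrow> ('a ^ 'v) set"
  assumes "finite E"
    and "\<And>X. X \<subseteq> E \<Longrightarrow> card X + (\<Sum>i<k. vec.dim (W i)) \<le> (\<Sum>i<k. vec.dim (W i \<union> v ` X))"
  shows "\<exists>c. (\<forall>e\<in>E. c e < k) \<and>
    (\<forall>i<k. vec.dim (W i) + card {e\<in>E. c e = i} \<le> vec.dim (W i \<union> v ` {e\<in>E. c e = i}))"
  using assms
proof (induction "card E" arbitrary: E W rule: less_induct)
  case less
  note fin = less.prems(1) and rank = less.prems(2)
  consider (empty) "E = {}"
    | (tight) X where "X \<subset> E" "X \<noteq> {}"
        "card X + (\<Sum>i<k. vec.dim (W i)) = (\<Sum>i<k. vec.dim (W i \<union> v ` X))"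
    | (slack) e where "e \<in> E"
        "\<And>X. X \<subset> E \<Longrightarrow> X \<noteq> {} \<Longrightarrow>
          card X + (\<Sum>i<k. vec.dim (W i)) < (\<Sum>i<k. vec.dim (W i \<union> v ` X))"
    using rank by (metis order_le_less psubset_imp_subset all_not_in_conv)
  then show ?case
  proof cases
    case empty
    then show ?thesis by simp
  next
    case tight
    define W' where "W' i = W i \<union> v ` X" for i
    have fX: "finite X" using tight fin by (meson finite_subset psubset_imp_subset)
    have "card X < card E" using tight fin by (simp add: psubset_card_mono)
    then have "\<exists>c. (\<forall>e\<in>X. c e < k) \<and>
        (\<forall>i<k. vec.dim (W i) + card {e\<in>X. c e = i} \<le> vec.dim (W i \<union> v ` {e\<in>X. c e = i}))"
      using rank tight(1) fX by (intro less.hyps) auto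
    then obtain c1 where c1: "\<forall>e\<in>X. c1 e < k"
        "\<forall>i<k. vec.dim (W i) + card {e\<in>X. c1 e = i} \<le> vec.dim (W i \<union> v ` {e\<in>X. c1 e = i})"
      by blast
    have "card (E - X) < card E"
      using tight fin by (intro psubset_card_mono) auto
    moreover have "card Y + (\<Sum>i<k. vec.dim (W' i)) \<le> (\<Sum>i<k. vec.dim (W' i \<union> v ` Y))"
      if "Y \<subseteq> E - X" for Y
    proof -
      have "card (X \<union> Y) = card X + card Y"
        using that fX fin by (intro card_Un_disjoint) (auto intro: finite_subset)
      then show ?thesis
        using rank[of "X \<union> Y"] that tight(1,3) by (simp add: W'_def image_Un Un_assoc subset_iff psubset_eq)
    qed
    ultimately have "\<exists>c. (\<forall>e\<in>E - X. c e < k) \<and>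
        (\<forall>i<k. vec.dim (W' i) + card {e\<in>E - X. c e = i}
          \<le> vec.dim (W' i \<union> v ` {e\<in>E - X. c e = i}))"
      using fin by (intro less.hyps) auto
    then obtain c2 where c2: "\<forall>e\<in>E - X. c2 e < k"
        "\<forall>i<k. vec.dim (W' i) + card {e\<in>E - X. c2 e = i}
          \<le> vec.dim (W' i \<union> v ` {e\<in>E - X. c2 e = i})"
      by blast
    define c where "c e = (if e \<in> X then c1 e else c2 e)" for e
    have "vec.dim (W i) + card {e\<in>E. c e = i} \<le> vec.dim (W i \<union> v ` {e\<in>E. c e = i})"
      if "i < k" for i
    proof -
      let ?A = "{e\<in>X. c1 e = i}" and ?B = "{e\<in>E - X. c2 e = i}"
      have AB: "{e\<in>E. c e = i} = ?A \<union> ?B" using tight by (auto simp: c_def)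
      have "card (?A \<union> ?B) = card ?A + card ?B"
        using fX fin by (intro card_Un_disjoint) auto
      moreover have "vec.dim (W' i \<union> v ` ?B) + vec.dim (W i \<union> v ` ?A)
          \<le> vec.dim (W i \<union> v ` ?A \<union> v ` ?B) + vec.dim (W' i)"
        using fin by (intro dim_Un_submodular) (auto simp: W'_def intro!: vec.span_mono)
      ultimately show ?thesis
        using c1(2)[rule_format, OF that] c2(2)[rule_format, OF that] by (simp add: AB image_Un Un_assoc)
    qed
    moreover have "\<forall>e\<in>E. c e < k" using c1(1) c2(1) by (auto simp: c_def)
    ultimately show ?thesis by blast
  next
    case slack
    have "\<exists>j<k. vec.dim (W j) < vec.dim (W j \<union> v ` {e})"
    proof (rule ccontr)
      assume "\<not> ?thesis"
      then have "(\<Sum>i<k. vec.dim (W i \<union> v ` {e})) \<le> (\<Sum>i<k. vec.dim (W i))"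
        by (intro sum_mono) (meson lessThan_iff not_less)
      then show False using rank[of "{e}"] slack(1) by simp
    qed
    then obtain j where j: "j < k" "vec.dim (W j) < vec.dim (insert (v e) (W j))"
      by auto
    have dim_j: "vec.dim (insert (v e) (W j)) = Suc (vec.dim (W j))"
      using j(2) by (auto simp: vec.dim_insert split: if_splits)
    define W' where "W' = W(j := insert (v e) (W j))"
    have sum_W': "(\<Sum>i<k. vec.dim (W' i)) = Suc (\<Sum>i<k. vec.dim (W i))"
    proof -
      have "(\<Sum>i<k. vec.dim (W' i)) = (\<Sum>i<k. vec.dim (W i) + (if i = j then 1 else 0))"
        by (rule sum.cong) (auto simp: W'_def dim_j)
      then show ?thesis using j(1) by (simp add: sum.distrib)
    qed
    have "card (E - {e}) < card E" using slack(1) fin by (intro card_Diff1_less)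
    moreover have "card Y + (\<Sum>i<k. vec.dim (W' i)) \<le> (\<Sum>i<k. vec.dim (W' i \<union> v ` Y))"
      if Y: "Y \<subseteq> E - {e}" for Y
    proof (cases "Y = {}")
      case False
      then have "card Y + Suc (\<Sum>i<k. vec.dim (W i)) \<le> (\<Sum>i<k. vec.dim (W i \<union> v ` Y))"
        using slack(1) slack(2)[of Y] Y by (auto simp: Suc_le_eq)
      also have "\<dots> \<le> (\<Sum>i<k. vec.dim (W' i \<union> v ` Y))"
        by (intro sum_mono vec.dim_subset) (auto simp: W'_def)
      finally show ?thesis by (simp add: sum_W')
    qed simp
    ultimately have "\<exists>c. (\<forall>x\<in>E - {e}. c x < k) \<and>
        (\<forall>i<k. vec.dim (W' i) + card {x\<in>E - {e}. c x = i}
          \<le> vec.dim (W' i \<union> v ` {x\<in>E - {e}. c x = i}))"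
      using fin by (intro less.hyps) auto
    then obtain c1 where c1: "\<forall>x\<in>E - {e}. c1 x < k"
        "\<forall>i<k. vec.dim (W' i) + card {x\<in>E - {e}. c1 x = i}
          \<le> vec.dim (W' i \<union> v ` {x\<in>E - {e}. c1 x = i})"
      by blast
    define c where "c = c1(e := j)"
    have "vec.dim (W i) + card {x\<in>E. c x = i} \<le> vec.dim (W i \<union> v ` {x\<in>E. c x = i})"
      if i: "i < k" for i
    proof (cases "i = j")
      case True
      let ?A = "{x\<in>E - {e}. c1 x = j}"
      have "{x\<in>E. c x = j} = insert e ?A" using slack(1) by (auto simp: c_def)
      moreover have "card (insert e ?A) = Suc (card ?A)" using fin by (simp add: card_insert_disjoint)
      ultimately show ?thesis using c1(2)[rule_format, OF i] True by (simp add: W'_def dim_j)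
    next
      case False
      then have "{x\<in>E. c x = i} = {x\<in>E - {e}. c1 x = i}" by (auto simp: c_def)
      then show ?thesis using c1(2)[rule_format, OF i] False by (simp add: W'_def)
    qed
    moreover have "\<forall>x\<in>E. c x < k" using c1(1) j(1) by (auto simp: c_def)
    ultimately show ?thesis by blast
  qed
qed

section \<open>Subspaces that contain many points\<close>

text \<open>
  This is the engine of the whole proof. If \<open>r\<close> classes, each independent modulo \<open>W\<close> and \<open>p\<close>,
  exhausted the points outside \<open>W\<close>, then the spans of \<open>W\<close> with each class would be \<open>r\<close> subspaces
  that avoid \<open>p\<close> and contain the rest of \<open>\<Gamma>\<close>. So there is no such partition, and the partition
  theorem provides a subspace that contains too many points for its dimension. The last hypothesis
  provides, for points that lie in \<open>W\<close> itself, at least one subspace that contains them.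
\<close>

lemma CB_dense_subspace_modulo:
  fixes W :: "('a::field ^ 'v::finite) set"
  assumes \<Gamma>: "\<Gamma> \<subseteq> proj_space" and fin: "finite \<Gamma>" and CB: "CB r \<Gamma>"
    and W: "vec.subspace W" and p: "p \<in> \<Gamma>" "p \<notin> proj_of W"
    and r: "0 < r \<or> \<Gamma> \<inter> proj_of W = {}"
  obtains U k where "vec.subspace U" "W \<subseteq> U" "p \<in> proj_of U" "vec.dim U = Suc (vec.dim W + k)"
    "r * k + 2 \<le> card (\<Gamma> \<inter> proj_of U - proj_of W)"
proof -
  have "\<exists>x. q \<in> \<Gamma> \<longrightarrow> x \<in> q \<and> x \<noteq> 0" for q
    using \<Gamma> proj_space_nonzero by (metis subsetD)
  then obtain v where v: "\<And>q. q \<in> \<Gamma> \<Longrightarrow> v q \<in> q \<and> v q \<noteq> 0" by metis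
  have mem: "q \<in> proj_of U \<longleftrightarrow> v q \<in> U" if "q \<in> \<Gamma>" "vec.subspace U" for q U
    using mem_proj_of_iff[of q "v q" U] v \<Gamma> that by auto
  define W' where "W' = insert (v p) W"
  have "v p \<notin> vec.span W" using mem p W by (metis vec.span_eq_iff)
  then have dim_W': "vec.dim W' = Suc (vec.dim W)" by (simp add: W'_def vec.dim_insert)
  define E where "E = \<Gamma> - proj_of W - {p}"
  have "\<exists>X\<subseteq>E. r * vec.dim (W' \<union> v ` X) < card X + r * vec.dim W'"
  proof (rule ccontr)
    assume "\<not> ?thesis"
    then have "card X + (\<Sum>i<r. vec.dim W') \<le> (\<Sum>i<r. vec.dim (W' \<union> v ` X))" if "X \<subseteq> E" for X
      using that by (auto simp: not_less)
    then obtain c where c: "\<forall>e\<in>E. c e < r"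
        "\<forall>i<r. vec.dim W' + card {e\<in>E. c e = i} \<le> vec.dim (W' \<union> v ` {e\<in>E. c e = i})"
      using partition_independent_modulo[of E "\<lambda>_. W'" r v] fin unfolding E_def by blast
    define U where "U i = vec.span (W \<union> v ` {e\<in>E. c e = i})" for i
    have p_U: "p \<notin> proj_of (U i)" if i: "i < r" for i
    proof
      assume "p \<in> proj_of (U i)"
      then have "v p \<in> vec.span (W \<union> v ` {e\<in>E. c e = i})"
        using mem p(1) by (simp add: U_def)
      then have "vec.dim (W' \<union> v ` {e\<in>E. c e = i}) = vec.dim (W \<union> v ` {e\<in>E. c e = i})"
        by (simp add: W'_def vec.dim_insert)
      moreover have "vec.dim (W \<union> v ` {e\<in>E. c e = i}) \<le> vec.dim W + card (v ` {e\<in>E. c e = i})"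
      proof -
        have "vec.dim (W \<union> B) \<le> vec.dim W + card B" if "finite B" for B
          using that by (induction B) (auto simp: vec.dim_insert)
        then show ?thesis using fin by (simp add: E_def)
      qed
      moreover have "card (v ` {e\<in>E. c e = i}) \<le> card {e\<in>E. c e = i}"
        using fin by (intro card_image_le) (simp add: E_def)
      ultimately show False using c(2)[rule_format, OF i] dim_W' by linarith
    qed
    obtain q where q: "q \<in> \<Gamma> - {p}" "\<forall>i<r. q \<notin> proj_of (U i)"
      using CB_not_covered_by_avoiding_subspaces[OF CB \<Gamma> p(1), of U] p_U
      by (auto simp: U_def)
    have "q \<in> proj_of (U (c q))" if "q \<in> E"
      using that q mem[of q "U (c q)"] by (auto simp: U_def intro!: vec.span_base)
    moreover have "q \<in> proj_of (U 0)" if "q \<in> proj_of W"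
      using that proj_of_mono[of W "U 0"] by (auto simp: U_def intro: vec.span_base)
    moreover have "q \<in> proj_of W \<or> q \<in> E" using q(1) by (auto simp only: E_def)
    ultimately show False
      using q c(1) r by blast
  qed
  then obtain X where X: "X \<subseteq> E" "r * vec.dim (W' \<union> v ` X) < card X + r * vec.dim W'" by blast
  \<comment> \<open>The set \<open>X\<close> violates the rank inequality by at least one, and \<open>p\<close> itself adds another
    point; together they account for the summand 2.\<close>
  define U where "U = vec.span (W' \<union> v ` X)"
  have "vec.dim W' \<le> vec.dim U" by (simp add: U_def vec.dim_subset)
  then obtain k where k: "vec.dim U = vec.dim W' + k" using le_Suc_ex by blast
  have "insert p X \<subseteq> \<Gamma> \<inter> proj_of U - proj_of W"
    using X(1) p mem[of _ U] by (auto simp: E_def U_def W'_def intro: vec.span_base)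
  then have "card (insert p X) \<le> card (\<Gamma> \<inter> proj_of U - proj_of W)"
    using fin by (intro card_mono) auto
  moreover have "card (insert p X) = Suc (card X)"
    using X(1) fin by (subst card_insert_disjoint) (auto simp: E_def intro: finite_subset)
  moreover have "r * k < card X"
    using X(2) k by (simp add: U_def algebra_simps)
  ultimately have "r * k + 2 \<le> card (\<Gamma> \<inter> proj_of U - proj_of W)" by simp
  moreover have "vec.subspace U" "W \<subseteq> U"
    by (auto simp: U_def W'_def intro: vec.span_base)
  moreover have "p \<in> proj_of U"
    using \<open>insert p X \<subseteq> _\<close> by auto
  ultimately show ?thesis using that k dim_W' by simp
qed

text \<open>
  The case \<open>W = 0\<close>. In projective terms, every point of a \<open>CB r\<close> set lies on a linear space of
  some dimension \<open>k > 0\<close> with at least \<open>r k + 2\<close> of the points. A rational normal curve of degree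
  \<open>k\<close> with \<open>r k + 2\<close> points on it attains this bound.
\<close>

lemma CB_dense_subspace:
  fixes \<Gamma> :: "('a::field ^ 'v::finite) set set"
  assumes "\<Gamma> \<subseteq> proj_space" "finite \<Gamma>" "CB r \<Gamma>" "p \<in> \<Gamma>"
  obtains U k where "vec.subspace U" "p \<in> proj_of U" "vec.dim U = Suc k" "1 \<le> k"
    "r * k + 2 \<le> card (\<Gamma> \<inter> proj_of U)"
proof -
  have zero: "proj_of {0::'a ^ 'v} = {}"
    by (auto simp: proj_of_def proj_space_def dest: vec.dim_subset)
  obtain U k where U: "vec.subspace U" "{0} \<subseteq> U" "p \<in> proj_of U"
    "vec.dim U = Suc (vec.dim {0::'a ^ 'v} + k)" "r * k + 2 \<le> card (\<Gamma> \<inter> proj_of U - proj_of {0})"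
    by (rule CB_dense_subspace_modulo[OF assms(1-3) vec.subspace_single_0 assms(4)])
      (auto simp: zero)
  then have "vec.dim U = Suc k" "r * k + 2 \<le> card (\<Gamma> \<inter> proj_of U)"
    by (simp_all add: zero)
  moreover have "1 \<le> k"
  proof (rule ccontr)
    assume "\<not> 1 \<le> k"
    then have "card (\<Gamma> \<inter> proj_of U) \<le> 1" using U by (intro card_Int_proj_of_le_1) auto
    then show False using \<open>r * k + 2 \<le> card (\<Gamma> \<inter> proj_of U)\<close> by simp
  qed
  ultimately show ?thesis using that U by blast
qed

definition CB_set :: "nat \<Rightarrow> ('a::field ^ 'v::finite) set set \<Rightarrow> bool" where
  "CB_set r \<Gamma> \<longleftrightarrow> \<Gamma> \<subseteq> proj_space \<and> finite \<Gamma> \<and> CB r \<Gamma>"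

lemma CB_set_finite: "CB_set r \<Gamma> \<Longrightarrow> finite \<Gamma>"
  by (simp add: CB_set_def)

lemma CB_set_excise:
  assumes "CB_set r \<Gamma>" "0 < r" "vec.subspace U"
  shows "CB_set (r - 1) (\<Gamma> - proj_of U)"
  using assms CB_excise[of "r - 1" \<Gamma> U] by (auto simp: CB_set_def)

text \<open>
  A dense subspace through a point would already contain \<open>r + 2\<close> points. This ends every excision
  argument below.
\<close>

lemma CB_set_empty:
  assumes "CB_set r \<Gamma>" "card \<Gamma> < r + 2"
  shows "\<Gamma> = {}"
proof (rule ccontr)
  assume "\<Gamma> \<noteq> {}"
  then obtain p where "p \<in> \<Gamma>" by blast
  then obtain U k where "1 \<le> k" "r * k + 2 \<le> card (\<Gamma> \<inter> proj_of U)"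
    using CB_dense_subspace assms(1) unfolding CB_set_def by metis
  moreover have "card (\<Gamma> \<inter> proj_of U) \<le> card \<Gamma>"
    using assms(1) by (intro card_mono) (auto simp: CB_set_def)
  moreover have "r * 1 \<le> r * k" using \<open>1 \<le> k\<close> by (rule mult_le_mono2)
  ultimately show False using assms(2) by linarith
qed

lemma card_split: "finite \<Gamma> \<Longrightarrow> card (\<Gamma> \<inter> A) + card (\<Gamma> - A) = card \<Gamma>"
  using card_Int_Diff[of \<Gamma> A] by simp

lemma card_excised:
  assumes "finite \<Gamma>"
  shows "card (\<Gamma> \<inter> proj_of (U \<inter> V)) + card ((\<Gamma> - proj_of U) \<inter> proj_of V) = card (\<Gamma> \<inter> proj_of V)"
proof -
  have "\<Gamma> \<inter> proj_of (U \<inter> V) = \<Gamma> \<inter> proj_of V \<inter> proj_of U" unfolding proj_of_Int by blast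
  moreover have "(\<Gamma> - proj_of U) \<inter> proj_of V = \<Gamma> \<inter> proj_of V - proj_of U" by blast
  ultimately show ?thesis using card_split[of "\<Gamma> \<inter> proj_of V" "proj_of U"] assms by simp
qed

lemma two_le_dim_of_card:
  "vec.subspace U \<Longrightarrow> 2 \<le> card (A \<inter> proj_of U) \<Longrightarrow> 2 \<le> vec.dim U"
  using card_Int_proj_of_le_1[of U A] by linarith

lemma dim_Int_less:
  assumes "vec.subspace U" "vec.subspace V" "\<not> V \<subseteq> U"
  shows "vec.dim (U \<inter> V) < vec.dim V"
  using assms vec.subspace_dim_equal[of "U \<inter> V" V] vec.subspace_inter[of U V]
  by (metis Int_lower1 Int_lower2 not_less)

lemma card_join:
  assumes "finite \<Gamma>"
  shows "card (\<Gamma> \<inter> proj_of U) + card (\<Gamma> \<inter> proj_of V)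
    \<le> card (\<Gamma> \<inter> proj_of (vec.span (U \<union> V))) + card (\<Gamma> \<inter> proj_of (U \<inter> V))"
proof -
  have "card (\<Gamma> \<inter> proj_of U) + card (\<Gamma> \<inter> proj_of V)
      = card (\<Gamma> \<inter> proj_of U \<union> \<Gamma> \<inter> proj_of V) + card (\<Gamma> \<inter> proj_of (U \<inter> V))"
    using card_Un_Int[of "\<Gamma> \<inter> proj_of U" "\<Gamma> \<inter> proj_of V"] assms
    by (simp add: proj_of_Int Int_ac)
  moreover have "card (\<Gamma> \<inter> proj_of U \<union> \<Gamma> \<inter> proj_of V) \<le> card (\<Gamma> \<inter> proj_of (vec.span (U \<union> V)))"
    using assms vec.span_superset[of "U \<union> V"]
    by (intro card_mono) (auto simp: proj_of_def)
  ultimately show ?thesis by simp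
qed

section \<open>Coverings by subspaces\<close>

text \<open>
  The subspaces of a plane configuration are listed in an order in which they are excised, so each
  only has to account for the points that the earlier ones missed. The numbers bound the length and
  the projective dimension from above, whereas \<open>vec.dim\<close> is the dimension of the affine cone, hence
  the shift by one and the requirement \<open>2 \<le> vec.dim U\<close> of positive projective dimension.
\<close>

inductive covered :: "nat \<Rightarrow> nat \<Rightarrow> ('a::field ^ 'v::finite) set set \<Rightarrow> bool" where
  empty: "covered l d {}"
| plane: "\<lbrakk>vec.subspace U; 2 \<le> vec.dim U; vec.dim U \<le> Suc k; covered l e (\<Gamma> - proj_of U);
    l < m; k + e \<le> d\<rbrakk> \<Longrightarrow> covered m d \<Gamma>"

lemma covered_mono: "covered l d \<Gamma> \<Longrightarrow> l \<le> l' \<Longrightarrow> d \<le> d' \<Longrightarrow> covered l' d' \<Gamma>"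
  by (induction rule: covered.induct) (auto intro: covered.intros)

lemma covered_one:
  assumes "vec.subspace U" "2 \<le> vec.dim U" "vec.dim U \<le> Suc d" "\<Gamma> \<subseteq> proj_of U"
  shows "covered 1 d \<Gamma>"
proof -
  have "\<Gamma> - proj_of U = {}" using assms(4) by auto
  then have "covered 0 0 (\<Gamma> - proj_of U)" by (simp only: covered.empty)
  then show ?thesis using assms covered.plane[of U d 0 0 \<Gamma> 1 d] by auto
qed

lemma covered_two:
  assumes "vec.subspace U" "2 \<le> vec.dim U" "vec.subspace V" "2 \<le> vec.dim V"
    "vec.dim U + vec.dim V \<le> d + 2" "\<Gamma> \<subseteq> proj_of U \<union> proj_of V"
  shows "covered 2 d \<Gamma>"
proof -
  have cov: "covered 1 (vec.dim V - 1) (\<Gamma> - proj_of U)"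
    by (rule covered_one[of V]) (use assms in auto)
  show ?thesis
    by (rule covered.plane[where k = "vec.dim U - 1", OF assms(1) _ _ cov]) (use assms in auto)
qed

lemma covered_imp_plane_config:
  "covered l d \<Gamma> \<Longrightarrow>
    \<exists>\<P>. plane_config \<P> \<and> lies_on \<Gamma> \<P> \<and> config_dim \<P> \<le> d \<and> config_length \<P> \<le> l"
proof (induction rule: covered.induct)
  case (empty l d)
  have "plane_config {} \<and> lies_on {} {} \<and> config_dim {} \<le> d \<and> config_length {} \<le> l"
    by (simp add: plane_config_def lies_on_def config_dim_def config_length_def)
  then show ?case by blast
next
  case (plane U k l e \<Gamma> m d)
  then obtain \<P> where P: "plane_config \<P>" "lies_on (\<Gamma> - proj_of U) \<P>" "config_dim \<P> \<le> e"
    "config_length \<P> \<le> l" by blast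
  have dim: "proj_dim (proj_of U) = vec.dim U - 1" using plane proj_dim_proj_of by blast
  have fin: "finite \<P>" using P by (simp add: plane_config_def)
  have "plane_config (insert (proj_of U) \<P>)"
    using P plane dim by (auto simp: plane_config_def linear_subspace_def)
  moreover have "lies_on \<Gamma> (insert (proj_of U) \<P>)" using P by (auto simp: lies_on_def)
  moreover have "config_dim (insert (proj_of U) \<P>) \<le> d"
    using P plane dim fin by (auto simp: config_dim_def sum.insert_if)
  moreover have "config_length (insert (proj_of U) \<P>) \<le> m"
    using P plane fin by (auto simp: config_length_def card_insert_if)
  ultimately show ?case by blast
qed

section \<open>Degree at most two\<close>

text \<open>
  Build a chain of subspaces, starting from a dense one and enlarging it modulo itself. Every step
  that adds \<open>k + 1\<close> dimensions captures at least \<open>r k + 2\<close> new points, and \<open>r k + 2 \<ge> r (k + 1)\<close>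
  because \<open>r \<le> 2\<close>. So the inequality persists along the chain, and a subspace satisfying it with
  the largest number of points contains all of them.
\<close>

lemma CB_span_dim:
  assumes CB: "CB_set r \<Gamma>" and r: "0 < r" "r \<le> 2" and ne: "\<Gamma> \<noteq> {}"
  obtains U where "vec.subspace U" "\<Gamma> \<subseteq> proj_of U" "r * vec.dim U + 2 \<le> card \<Gamma> + r"
proof -
  have \<Gamma>: "\<Gamma> \<subseteq> proj_space" "finite \<Gamma>" "CB r \<Gamma>" using CB by (auto simp: CB_set_def)
  define good where "good U \<longleftrightarrow> vec.subspace U \<and> r * vec.dim U + 2 \<le> card (\<Gamma> \<inter> proj_of U) + r" for U
  obtain p where "p \<in> \<Gamma>" using ne by blast
  then obtain U0 k where "vec.subspace U0" "p \<in> proj_of U0" "vec.dim U0 = Suc k" "1 \<le> k"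
      "r * k + 2 \<le> card (\<Gamma> \<inter> proj_of U0)"
    by (rule CB_dense_subspace[OF \<Gamma>])
  then have "good U0" by (simp add: good_def)
  moreover have "card (\<Gamma> \<inter> proj_of V) < Suc (card \<Gamma>)" for V
    using \<Gamma>(2) by (simp add: card_mono less_Suc_eq_le)
  ultimately obtain U where U: "good U"
      and max: "\<And>V. good V \<Longrightarrow> card (\<Gamma> \<inter> proj_of V) \<le> card (\<Gamma> \<inter> proj_of U)"
    using ex_has_greatest_nat[of good U0 "\<lambda>V. card (\<Gamma> \<inter> proj_of V)" "Suc (card \<Gamma>)"]
    by (auto simp: less_imp_le)
  have "\<Gamma> \<subseteq> proj_of U"
  proof
    fix p assume p: "p \<in> \<Gamma>"
    show "p \<in> proj_of U"
    proof (rule ccontr)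
      assume "p \<notin> proj_of U"
      moreover have "vec.subspace U" "0 < r \<or> \<Gamma> \<inter> proj_of U = {}" using U r by (auto simp: good_def)
      ultimately obtain V k where V: "vec.subspace V" "U \<subseteq> V" "p \<in> proj_of V"
          "vec.dim V = Suc (vec.dim U + k)" "r * k + 2 \<le> card (\<Gamma> \<inter> proj_of V - proj_of U)"
        using CB_dense_subspace_modulo[OF \<Gamma> _ p] by blast
      have "card (\<Gamma> \<inter> proj_of V) = card (\<Gamma> \<inter> proj_of U) + card (\<Gamma> \<inter> proj_of V - proj_of U)"
        using card_split[of "\<Gamma> \<inter> proj_of V" "proj_of U"] proj_of_mono[OF V(2)] \<Gamma>(2)
        by (simp add: Int_assoc Int_absorb1)
      moreover from this have "good V"
        using U V r(2) unfolding good_def by (simp add: algebra_simps)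
      ultimately show False using max[of V] V(5) by simp
    qed
  qed
  moreover from this have "\<Gamma> \<inter> proj_of U = \<Gamma>" by blast
  ultimately show ?thesis using that[of U] U by (simp add: good_def)
qed

lemma CB_covered_single:
  assumes CB: "CB_set r \<Gamma>" and r: "r \<le> 2" and card: "card \<Gamma> \<le> (d + 1) * r + 1"
  shows "covered 1 d \<Gamma>"
proof (cases "r = 0 \<or> \<Gamma> = {}")
  case True
  then have "\<Gamma> = {}" using CB card CB_set_empty[of 0 \<Gamma>] by auto
  then show ?thesis by (simp add: covered.empty)
next
  case False
  then obtain U where U: "vec.subspace U" "\<Gamma> \<subseteq> proj_of U" "r * vec.dim U + 2 \<le> card \<Gamma> + r"
    using CB_span_dim[OF CB _ r] by auto
  have "r * vec.dim U < r * (d + 2)" using U(3) card by (simp add: algebra_simps)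
  then have "vec.dim U < d + 2" by (simp only: mult_less_cancel1)
  then have "vec.dim U \<le> Suc d" by simp
  moreover have "2 \<le> vec.dim U"
  proof (rule two_le_dim_of_card[OF U(1)])
    show "2 \<le> card (\<Gamma> \<inter> proj_of U)"
      using CB_set_empty[OF CB] False U(2) by (cases "card \<Gamma> < r + 2") (auto simp: Int_absorb2)
  qed
  ultimately show ?thesis using U covered_one by blast
qed

section \<open>Dimension at most three\<close>

text \<open>
  The bound leaves only \<open>k = 1\<close> for a dense subspace, and at most \<open>r - 1\<close> points off that line.
  They are \<open>CB (r - 1)\<close>, hence absent.
\<close>

lemma CB_on_line:
  assumes CB: "CB_set r \<Gamma>" and card: "card \<Gamma> \<le> 2 * r + 1" and ne: "\<Gamma> \<noteq> {}"
  obtains L where "vec.subspace L" "vec.dim L = 2" "\<Gamma> \<subseteq> proj_of L"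
proof -
  note fin = CB_set_finite[OF CB]
  obtain p where "p \<in> \<Gamma>" using ne by blast
  then obtain U k where U: "vec.subspace U" "vec.dim U = Suc k" "1 \<le> k"
      "r * k + 2 \<le> card (\<Gamma> \<inter> proj_of U)"
    using CB_dense_subspace CB unfolding CB_set_def by metis
  note split = card_split[OF fin, of "proj_of U"]
  have "r * k < r * 2" using U(4) card split by linarith
  then have k: "k = 1" "0 < r" using U(3) by auto
  have "card (\<Gamma> - proj_of U) < (r - 1) + 2" using split U(4) card k by simp
  then have "\<Gamma> - proj_of U = {}" using CB_set_empty CB_set_excise[OF CB k(2) U(1)] by blast
  then show ?thesis using that U k by auto
qed

lemma CB_covered_line:
  assumes "CB_set r \<Gamma>" "card \<Gamma> \<le> 2 * r + 1"
  shows "covered 1 1 \<Gamma>"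
proof (cases "\<Gamma> = {}")
  case False
  then show ?thesis using CB_on_line[OF assms] covered_one by (metis One_nat_def Suc_1 order_refl)
qed (simp add: covered.empty)

text \<open>
  A dense plane leaves too few points for a further one, and a dense line leaves few enough to lie on
  a second line.
\<close>

lemma CB_covered_dim_2:
  assumes CB: "CB_set r \<Gamma>" and card: "card \<Gamma> \<le> 3 * r + 1"
  shows "covered 2 2 \<Gamma>"
proof (cases "\<Gamma> = {}")
  case False
  note fin = CB_set_finite[OF CB]
  obtain p where "p \<in> \<Gamma>" using False by blast
  then obtain U k where U: "vec.subspace U" "vec.dim U = Suc k" "1 \<le> k"
      "r * k + 2 \<le> card (\<Gamma> \<inter> proj_of U)"
    using CB_dense_subspace CB unfolding CB_set_def by metis
  note split = card_split[OF fin, of "proj_of U"]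
  have "r * k < r * 3" using U(4) card split by linarith
  then have r: "0 < r" and k: "k = 1 \<or> k = 2" using U(3) by auto
  note CB' = CB_set_excise[OF CB r U(1)]
  from k show ?thesis
  proof
    assume "k = 1"
    then have cov: "covered 1 1 (\<Gamma> - proj_of U)"
      using split U(4) card r by (intro CB_covered_line[OF CB']) simp
    show ?thesis
      by (rule covered.plane[where k = 1, OF U(1) _ _ cov]) (use U \<open>k = 1\<close> in auto)
  next
    assume "k = 2"
    then have "\<Gamma> - proj_of U = {}"
      using split U(4) card r by (intro CB_set_empty[OF CB']) simp
    then have cov: "covered 1 2 \<Gamma>"
      using U \<open>k = 2\<close> covered_one[of U 2 \<Gamma>] by auto
    then show ?thesis by (rule covered_mono) auto
  qed
qed (simp add: covered.empty)

text \<open>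
  Distinct lines with \<open>r + 2\<close> points never share a point of \<open>\<Gamma>\<close>, since their plane would contain \<open>2 r + 3\<close>
  points. So each new line takes \<open>r + 2\<close> further points, and after three lines at most \<open>r - 2\<close>
  points remain, which is too few for the \<open>CB (r - 3)\<close> condition.
\<close>

lemma CB_lines:
  assumes CB: "CB_set r \<Gamma>" and r: "3 \<le> r" and ne: "\<Gamma> \<noteq> {}" and card: "card \<Gamma> \<le> 4 * r + 4"
    and line: "\<forall>p\<in>\<Gamma>. \<exists>L. vec.subspace L \<and> vec.dim L = 2 \<and> p \<in> proj_of L \<and> r + 2 \<le> card (\<Gamma> \<inter> proj_of L)"
    and no_plane: "\<forall>U. vec.subspace U \<and> vec.dim U = 3 \<longrightarrow> card (\<Gamma> \<inter> proj_of U) < 2 * r + 2"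
  obtains
    (two) L M where "vec.subspace L" "vec.dim L = 2" "vec.subspace M" "vec.dim M = 2"
      "\<Gamma> \<subseteq> proj_of L \<union> proj_of M"
  | (three) L M N where "vec.subspace L" "vec.dim L = 2" "vec.subspace M" "vec.dim M = 2"
      "vec.subspace N" "vec.dim N = 2" "\<Gamma> \<subseteq> proj_of L \<union> proj_of M \<union> proj_of N"
      "3 * r + 6 \<le> card \<Gamma>"
proof -
  note fin = CB_set_finite[OF CB]
  define rich where "rich L \<longleftrightarrow> vec.subspace L \<and> vec.dim L = 2 \<and> r + 2 \<le> card (\<Gamma> \<inter> proj_of L)" for L
  have disjoint: "\<Gamma> \<inter> proj_of L \<inter> proj_of M = {}"
    if L: "rich L" and M: "rich M" and p: "p \<in> \<Gamma>" "p \<in> proj_of M" "p \<notin> proj_of L" for L M p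
  proof (rule ccontr)
    assume "\<Gamma> \<inter> proj_of L \<inter> proj_of M \<noteq> {}"
    then obtain q where q: "q \<in> proj_of (L \<inter> M)" by (auto simp: proj_of_Int)
    have "\<not> M \<subseteq> L" using p proj_of_mono by blast
    then have "vec.dim (L \<inter> M) < 2" using dim_Int_less[of L M] L M by (simp add: rich_def)
    moreover have "1 \<le> vec.dim (L \<inter> M)"
      using q vec.dim_subset[of q "L \<inter> M"] by (simp add: proj_of_def proj_space_def)
    ultimately have "vec.dim (vec.span (L \<union> M)) = 3"
      using dim_span_Un[of L M] L M by (simp add: rich_def)
    moreover have "card (\<Gamma> \<inter> proj_of (L \<inter> M)) \<le> 1"
      using \<open>vec.dim (L \<inter> M) < 2\<close> L M by (intro card_Int_proj_of_le_1 vec.subspace_inter) (auto simp: rich_def)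
    ultimately show False
      using no_plane[rule_format, of "vec.span (L \<union> M)"] card_join[OF fin, of L M] L M by (simp add: rich_def)
  qed
  have ex_line: "\<exists>L. rich L \<and> p \<in> proj_of L" if "p \<in> \<Gamma>" for p
    using line that unfolding rich_def by blast
  obtain p1 where "p1 \<in> \<Gamma>" using ne by blast
  then obtain L where L: "rich L" using ex_line by blast
  let ?A = "\<Gamma> - proj_of L"
  have A: "card ?A + (r + 2) \<le> card \<Gamma>" using card_split[OF fin, of "proj_of L"] L by (simp add: rich_def)
  show ?thesis
  proof (cases "?A = {}")
    case True
    then show ?thesis using two[of L L] L by (auto simp: rich_def)
  next
    case False
    then obtain p2 where p2: "p2 \<in> ?A" by blast
    then obtain M where M: "rich M" "p2 \<in> proj_of M" using ex_line by blast
    have "?A \<inter> proj_of M = \<Gamma> \<inter> proj_of M" using disjoint[OF L M(1)] M p2 by blast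
    then have B: "card (?A - proj_of M) + (r + 2) \<le> card ?A"
      using card_split[of ?A "proj_of M"] M fin by (simp add: rich_def)
    show ?thesis
    proof (cases "?A - proj_of M = {}")
      case True
      then have "\<Gamma> \<subseteq> proj_of L \<union> proj_of M" by blast
      then show ?thesis using two[of L M] L M unfolding rich_def by blast
    next
      case False
      then obtain p3 where p3: "p3 \<in> ?A - proj_of M" by blast
      then obtain N where N: "rich N" "p3 \<in> proj_of N" using ex_line by blast
      let ?C = "?A - proj_of M - proj_of N"
      have "(?A - proj_of M) \<inter> proj_of N = \<Gamma> \<inter> proj_of N"
        using disjoint[OF L N(1)] disjoint[OF M(1) N(1)] N p3 by blast
      then have C: "card ?C + (r + 2) \<le> card (?A - proj_of M)"
        using card_split[of "?A - proj_of M" "proj_of N"] N fin by (simp add: rich_def)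
      have "CB_set (r - 1 - 1 - 1) ?C"
        using CB L M N r by (intro CB_set_excise) (auto simp: rich_def)
      moreover have "card ?C < (r - 1 - 1 - 1) + 2" using A B C card r by linarith
      ultimately have "?C = {}" using CB_set_empty by blast
      then have "\<Gamma> \<subseteq> proj_of L \<union> proj_of M \<union> proj_of N" by blast
      moreover have "3 * r + 6 \<le> card \<Gamma>" using A B C by linarith
      ultimately show ?thesis using three[of L M N] L M N unfolding rich_def by blast
    qed
  qed
qed

text \<open>
  Excising a dense line first may leave one point too many. Therefore a dense subspace of larger
  dimension is preferred, and what it leaves, if anything, lies on a line. If there is none, every point lies on a
  line with \<open>r + 2\<close> of the points. Three such lines need \<open>3 r + 6 \<le> 4 r + 1\<close>, that is
  \<open>r \<ge> 5\<close>, which is where the bound on the length comes from.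
\<close>

lemma CB_covered_dim_3:
  fixes \<Gamma> :: "('a::field ^ 'v::finite) set set"
  assumes CB: "CB_set r \<Gamma>" and card: "card \<Gamma> \<le> 4 * r + 1"
  shows "covered (if r \<le> 4 then 2 else 3) 3 \<Gamma>"
proof -
  note fin = CB_set_finite[OF CB]
  consider "\<Gamma> = {}" | "r \<le> 2" | "3 \<le> r" "\<Gamma> \<noteq> {}" by linarith
  then show ?thesis
  proof cases
    case 2
    then have "covered 1 3 \<Gamma>" using card by (intro CB_covered_single[OF CB]) auto
    then show ?thesis by (rule covered_mono) auto
  next
    case 3
    show ?thesis
    proof (cases "\<exists>U k. vec.subspace U \<and> vec.dim U = Suc k \<and> 2 \<le> k \<and> r * k + 2 \<le> card (\<Gamma> \<inter> proj_of U)")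
      case True
      then obtain U k where U: "vec.subspace U" "vec.dim U = Suc k" "2 \<le> k"
        "r * k + 2 \<le> card (\<Gamma> \<inter> proj_of U)" by blast
      note split = card_split[OF fin, of "proj_of U"]
      have "r * k < r * 4" using U(4) card split by linarith
      then have r: "0 < r" and k: "k = 2 \<or> k = 3" using U(3) by auto
      note CB' = CB_set_excise[OF CB r U(1)]
      from k have "covered 2 3 \<Gamma>"
      proof
        assume "k = 2"
        then have cov: "covered 1 1 (\<Gamma> - proj_of U)"
          using split U(4) card r by (intro CB_covered_line[OF CB']) simp
        show ?thesis
      by (rule covered.plane[where k = 2, OF U(1) _ _ cov]) (use U \<open>k = 2\<close> in auto)
      next
        assume "k = 3"
        then have "\<Gamma> - proj_of U = {}"
          using split U(4) card r by (intro CB_set_empty[OF CB']) simp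
        then have cov: "covered 1 3 \<Gamma>"
      using U \<open>k = 3\<close> covered_one[of U 3 \<Gamma>] by auto
    then show ?thesis by (rule covered_mono) auto
      qed
      then show ?thesis by (rule covered_mono) auto
    next
      case False
      have line: "\<forall>p\<in>\<Gamma>. \<exists>L. vec.subspace L \<and> vec.dim L = 2 \<and> p \<in> proj_of L \<and>
          r + 2 \<le> card (\<Gamma> \<inter> proj_of L)"
      proof
        fix p assume p: "p \<in> \<Gamma>"
        obtain U k where U: "vec.subspace U" "p \<in> proj_of U" "vec.dim U = Suc k" "1 \<le> k"
            "r * k + 2 \<le> card (\<Gamma> \<inter> proj_of U)"
          using CB_dense_subspace CB p unfolding CB_set_def by metis
        then have "k = 1" using False by (metis One_nat_def Suc_1 le_antisym not_less_eq_eq)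
        then show "\<exists>L. vec.subspace L \<and> vec.dim L = 2 \<and> p \<in> proj_of L \<and>
            r + 2 \<le> card (\<Gamma> \<inter> proj_of L)" using U by auto
      qed
      have no_plane: "\<forall>U. vec.subspace U \<and> vec.dim U = 3 \<longrightarrow> card (\<Gamma> \<inter> proj_of U) < 2 * r + 2"
      proof (intro allI impI, rule ccontr)
        fix U :: "('a ^ 'v) set"
        assume "vec.subspace U \<and> vec.dim U = 3" "\<not> card (\<Gamma> \<inter> proj_of U) < 2 * r + 2"
        then have "vec.subspace U \<and> vec.dim U = Suc 2 \<and> 2 \<le> (2::nat) \<and> r * 2 + 2 \<le> card (\<Gamma> \<inter> proj_of U)"
          by simp
        then show False using False by blast
      qed
      have "card \<Gamma> \<le> 4 * r + 4" using card by simp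
      from CB 3 this line no_plane show ?thesis
      proof (cases rule: CB_lines)
        case (two L M)
        then have "covered 2 3 \<Gamma>" using covered_two[of L M 3 \<Gamma>] by simp
        then show ?thesis by (rule covered_mono) auto
      next
        case (three L M N)
        then have "\<not> r \<le> 4" using card by simp
        moreover have cov: "covered 2 2 (\<Gamma> - proj_of L)"
          by (rule covered_two[of M N]) (use three in auto)
        have "covered 3 3 \<Gamma>"
          by (rule covered.plane[where k = 1, OF three(1) _ _ cov]) (use three in auto)
        ultimately show ?thesis by simp
      qed
    qed
  qed (simp add: covered.empty)
qed

section \<open>Cubics and dimension four\<close>

text \<open>
  Let \<open>a\<close> be the number of points on both planes. At most \<open>a\<close> points lie off the two planes. They are
  \<open>CB 1\<close>, so \<open>a \<le> 2\<close> would leave none; hence the planes meet in a line and span a solid.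
  This solid has at least \<open>16 - a\<close> points, so \<open>a \<ge> 6\<close>. On the other hand, a line with seven points
  would leave at most nine, which lie on a solid because they are \<open>CB 2\<close>.
\<close>

lemma CB_3_planes_share_line:
  assumes CB: "CB_set 3 \<Gamma>" and card: "card \<Gamma> \<le> 16" and nc: "\<not> covered 2 4 \<Gamma>"
    and no_solid: "\<forall>U. vec.subspace U \<and> vec.dim U \<le> 4 \<longrightarrow> card (\<Gamma> \<inter> proj_of U) \<le> 10"
    and P: "vec.subspace P" "vec.dim P = 3" "8 \<le> card (\<Gamma> \<inter> proj_of P)"
    and Q: "vec.subspace Q" "vec.dim Q = 3" "8 \<le> card (\<Gamma> \<inter> proj_of Q)"
    and PQ: "\<not> Q \<subseteq> P"
  shows "vec.dim (P \<inter> Q) = 2" "card (\<Gamma> \<inter> proj_of (P \<inter> Q)) = 6"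
proof -
  note fin = CB_set_finite[OF CB]
  let ?M = "P \<inter> Q" and ?J = "vec.span (P \<union> Q)"
  have M: "vec.subspace ?M" using P Q by (intro vec.subspace_inter)
  have M3: "vec.dim ?M < 3" using dim_Int_less[OF P(1) Q(1) PQ] Q by simp
  have rest: "CB_set 1 (\<Gamma> - proj_of P - proj_of Q)"
    using CB_set_excise[OF CB_set_excise[OF CB _ P(1)] _ Q(1)] by simp
  have rest_card: "card (\<Gamma> - proj_of P - proj_of Q) \<le> card (\<Gamma> \<inter> proj_of ?M)"
    using card_split[OF fin, of "proj_of P"] card_split[of "\<Gamma> - proj_of P" "proj_of Q"]
      card_excised[OF fin, of P Q] fin card P(3) Q(3) by simp
  have "3 \<le> card (\<Gamma> \<inter> proj_of ?M)"
  proof (rule ccontr)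
    assume "\<not> ?thesis"
    then have "\<Gamma> - proj_of P - proj_of Q = {}"
      using CB_set_empty[OF rest] rest_card by simp
    then have "covered 2 4 \<Gamma>" using covered_two[of P Q 4 \<Gamma>] P Q by auto
    then show False using nc by blast
  qed
  then have "2 \<le> vec.dim ?M" using two_le_dim_of_card[OF M, of \<Gamma>] by simp
  then show dimM: "vec.dim ?M = 2" using M3 by simp
  then have "vec.dim ?J = 4" using dim_span_Un[OF P(1) Q(1)] P Q by simp
  then have "card (\<Gamma> \<inter> proj_of ?J) \<le> 10" using no_solid by simp
  then have "6 \<le> card (\<Gamma> \<inter> proj_of ?M)" using card_join[OF fin, of P Q] P Q by linarith
  moreover have "card (\<Gamma> \<inter> proj_of ?M) < 7"
  proof (rule ccontr)
    assume "\<not> ?thesis"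
    then have "card (\<Gamma> - proj_of ?M) \<le> 9" using card_split[OF fin, of "proj_of ?M"] card by simp
    then have cov: "covered 1 3 (\<Gamma> - proj_of ?M)"
      using CB_covered_single[OF CB_set_excise[OF CB _ M], of 3] by simp
    have "covered 2 4 \<Gamma>"
      by (rule covered.plane[where k = 1, OF M _ _ cov]) (use dimM in auto)
    then show False using nc by blast
  qed
  ultimately show "card (\<Gamma> \<inter> proj_of ?M) = 6" by simp
qed

text \<open>
  Two such planes span a solid \<open>S\<close> with ten points, and the other at most six points form a \<open>CB 2\<close>
  set \<open>R\<close>. A line with four points of \<open>R\<close> would contain all of \<open>R\<close>. Some point of \<open>R\<close> lies on a rich
  line or on a third rich plane. A rich line meets \<open>S\<close> in at most one point, so it has four points in
  \<open>R\<close>. A third rich plane has six points in common with \<open>P\<close>, which has only eight, so it passes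
  through the line \<open>P \<inter> Q\<close>. Then its span with \<open>S\<close> has dimension four and leaves either no points or
  four points, which are collinear.
\<close>

lemma CB_3_rich_plane_unique:
  assumes CB: "CB_set 3 \<Gamma>" and card: "card \<Gamma> \<le> 16" and nc: "\<not> covered 2 4 \<Gamma>"
    and no_solid: "\<forall>U. vec.subspace U \<and> vec.dim U \<le> 4 \<longrightarrow> card (\<Gamma> \<inter> proj_of U) \<le> 10"
    and dense: "\<forall>p\<in>\<Gamma>. \<exists>U. vec.subspace U \<and> p \<in> proj_of U \<and>
        (vec.dim U = 2 \<and> 5 \<le> card (\<Gamma> \<inter> proj_of U) \<or> vec.dim U = 3 \<and> 8 \<le> card (\<Gamma> \<inter> proj_of U))"
    and P: "vec.subspace P" "vec.dim P = 3" "8 \<le> card (\<Gamma> \<inter> proj_of P)"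
    and Q: "vec.subspace Q" "vec.dim Q = 3" "8 \<le> card (\<Gamma> \<inter> proj_of Q)"
  shows "Q \<subseteq> P"
proof (rule ccontr)
  assume PQ: "\<not> Q \<subseteq> P"
  note fin = CB_set_finite[OF CB]
  note meet = CB_3_planes_share_line[OF CB card nc no_solid]
  define M where "M = P \<inter> Q"
  define S where "S = vec.span (P \<union> Q)"
  have dimM: "vec.dim M = 2" and cardM: "card (\<Gamma> \<inter> proj_of M) = 6"
    using meet[OF P Q PQ] by (simp_all add: M_def)
  have M: "vec.subspace M" using P Q by (simp add: M_def vec.subspace_inter)
  have S: "vec.subspace S" by (simp add: S_def)
  have dimS: "vec.dim S = 4" using dim_span_Un[OF P(1) Q(1)] P Q dimM by (simp add: S_def M_def)
  have PS: "P \<subseteq> S" and QS: "Q \<subseteq> S" by (auto simp: S_def intro: vec.span_base)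
  have cardS: "10 \<le> card (\<Gamma> \<inter> proj_of S)"
    using card_join[OF fin, of P Q] P Q cardM by (simp add: S_def M_def)
  have cardP: "card (\<Gamma> \<inter> proj_of P) \<le> 8"
  proof -
    have "card (\<Gamma> \<inter> proj_of S) \<le> 10" using no_solid S dimS by simp
    then show ?thesis using card_join[OF fin, of P Q] Q cardM by (simp add: S_def M_def)
  qed
  let ?R = "\<Gamma> - proj_of S"
  have CB_R: "CB_set 2 ?R" using CB_set_excise[OF CB _ S] by simp
  have cardR: "card ?R \<le> 6" using card_split[OF fin, of "proj_of S"] cardS card by simp
  have no_line: "card (?R \<inter> proj_of N) < 4" if N: "vec.subspace N" "vec.dim N = 2" for N
  proof (rule ccontr)
    assume "\<not> ?thesis"
    then have "card (?R - proj_of N) < 1 + 2"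
      using card_split[of ?R "proj_of N"] fin cardR by simp
    moreover have "CB_set 1 (?R - proj_of N)" using CB_set_excise[OF CB_R _ N(1)] by simp
    ultimately have "?R - proj_of N = {}" using CB_set_empty by blast
    then have "covered 2 4 \<Gamma>" using covered_two[of S N 4 \<Gamma>] S N dimS by auto
    then show False using nc by blast
  qed
  have "?R \<noteq> {}"
  proof
    assume "?R = {}"
    then have "covered 1 4 \<Gamma>" using covered_one[of S 4 \<Gamma>] S dimS by auto
    then show False using nc covered_mono[of 1 4 \<Gamma> 2 4] by simp
  qed
  then obtain p where p: "p \<in> \<Gamma>" "p \<notin> proj_of S" by blast
  then obtain U where U: "vec.subspace U" "p \<in> proj_of U"
      "vec.dim U = 2 \<and> 5 \<le> card (\<Gamma> \<inter> proj_of U) \<or> vec.dim U = 3 \<and> 8 \<le> card (\<Gamma> \<inter> proj_of U)"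
    using dense by blast
  have U_S: "\<not> U \<subseteq> S" using p U(2) proj_of_mono by blast
  have dimSU: "vec.dim (S \<inter> U) < vec.dim U" by (rule dim_Int_less[OF S U(1) U_S])
  have SU: "vec.subspace (S \<inter> U)" using S U by (intro vec.subspace_inter)
  from U(3) show False
  proof (elim disjE conjE)
    assume U2: "vec.dim U = 2" "5 \<le> card (\<Gamma> \<inter> proj_of U)"
    have "card (\<Gamma> \<inter> proj_of (S \<inter> U)) \<le> 1" using dimSU U2 by (intro card_Int_proj_of_le_1[OF SU]) simp
    then show False
      using card_excised[OF fin, of S U] no_line[OF U(1) U2(1)] U2(2) by linarith
  next
    assume U3: "vec.dim U = 3" "8 \<le> card (\<Gamma> \<inter> proj_of U)"
    have "\<not> U \<subseteq> P" using U_S PS by blast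
    note PU = meet[OF P U(1) U3 this]
    have PU_sub: "vec.subspace (P \<inter> U)" using P U by (intro vec.subspace_inter)
    have M_PU: "vec.subspace (M \<inter> (P \<inter> U))" using M PU_sub by (rule vec.subspace_inter)
    have "card (\<Gamma> \<inter> proj_of (vec.span (M \<union> (P \<inter> U)))) \<le> card (\<Gamma> \<inter> proj_of P)"
      using fin P(1) by (intro card_mono Int_mono proj_of_mono vec.span_minimal) (auto simp: M_def)
    then have "2 \<le> card (\<Gamma> \<inter> proj_of (M \<inter> (P \<inter> U)))"
      using card_join[OF fin, of M "P \<inter> U"] cardM PU cardP by simp
    then have "2 \<le> vec.dim (M \<inter> (P \<inter> U))" by (rule two_le_dim_of_card[OF M_PU])
    then have "M \<inter> (P \<inter> U) = M" 
      using vec.subspace_dim_equal[OF M_PU M] dimM by simp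
    then have "M \<subseteq> S \<inter> U" using PS by (auto simp: M_def)
    then have SU_M: "M = S \<inter> U"
      using vec.subspace_dim_equal[OF M SU] dimSU U3 dimM by simp
    define T where "T = vec.span (S \<union> U)"
    have T: "vec.subspace T" by (simp add: T_def)
    have dimT: "vec.dim T = 5"
      using dim_span_Un[OF S U(1)] dimS dimM U3 SU_M by (simp add: T_def)
    have "12 \<le> card (\<Gamma> \<inter> proj_of T)"
      using card_join[OF fin, of S U] cardS cardM U3 SU_M by (simp add: T_def)
    then have rest: "card (\<Gamma> - proj_of T) \<le> 4" using card_split[OF fin, of "proj_of T"] card by simp
    have CB_T: "CB_set 2 (\<Gamma> - proj_of T)" using CB_set_excise[OF CB _ T] by simp
    show False
    proof (cases "\<Gamma> - proj_of T = {}")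
      case True
      then have "covered 1 4 \<Gamma>" using covered_one[of T 4 \<Gamma>] T dimT by auto
      then show False using nc covered_mono[of 1 4 \<Gamma> 2 4] by simp
    next
      case False
      then have "\<not> card (\<Gamma> - proj_of T) < 4" using CB_set_empty[OF CB_T] by auto
      obtain N where N: "vec.subspace N" "vec.dim N = 2" "\<Gamma> - proj_of T \<subseteq> proj_of N"
        using CB_on_line[OF CB_T _ False] rest by auto
      have "proj_of S \<subseteq> proj_of T" by (intro proj_of_mono) (auto simp: T_def intro: vec.span_base)
      then have "card (\<Gamma> - proj_of T) \<le> card (?R \<inter> proj_of N)"
        using N(3) fin by (intro card_mono) auto
      then show False using no_line[OF N(1,2)] \<open>\<not> card (\<Gamma> - proj_of T) < 4\<close> by simp
    qed
  qed
qed

text \<open>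
  A solid with eleven points leaves at most five, which are \<open>CB 2\<close> and hence collinear. A subspace of
  dimension four with fourteen points leaves none. Otherwise every point lies on a line with five or a
  plane with eight of the points. If there is no such plane, \<open>\<Gamma>\<close> lies on three lines, two of which span
  a solid. If there is such a plane, it is unique, and exactly eight points lie off it. They lie on
  lines with five points, which do not meet \<open>\<Gamma>\<close> on the plane because the two would span a solid
  with at least twelve points. Two such lines have nine points, which is too many.
\<close>

lemma CB_3_covered_dim_4:
  fixes \<Gamma> :: "('a::field ^ 'v::finite) set set"
  assumes CB: "CB_set 3 \<Gamma>" and card: "card \<Gamma> \<le> 16"
  shows "covered 2 4 \<Gamma>"
proof (rule ccontr)
  assume nc: "\<not> ?thesis"
  note fin = CB_set_finite[OF CB]
  have no_solid: "\<forall>U. vec.subspace U \<and> vec.dim U \<le> 4 \<longrightarrow> card (\<Gamma> \<inter> proj_of U) \<le> 10"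
  proof (intro allI impI, rule ccontr)
    fix U :: "('a ^ 'v) set"
    assume "vec.subspace U \<and> vec.dim U \<le> 4" and "\<not> card (\<Gamma> \<inter> proj_of U) \<le> 10"
    then have U: "vec.subspace U" "vec.dim U \<le> 4" and "card (\<Gamma> - proj_of U) \<le> 2 * 2 + 1" and U2: "2 \<le> card (\<Gamma> \<inter> proj_of U)"
      using card_split[OF fin, of "proj_of U"] card by auto
    then have cov: "covered 1 1 (\<Gamma> - proj_of U)"
      using CB_covered_line[of 2] CB_set_excise[OF CB _ U(1)] by simp
    have "covered 2 4 \<Gamma>"
      by (rule covered.plane[where k = 3, OF U(1) two_le_dim_of_card[OF U(1) U2] _ cov]) (use U in auto)
    then show False using nc by blast
  qed
  have no_hyper: "card (\<Gamma> \<inter> proj_of U) \<le> 13" if U: "vec.subspace U" "vec.dim U \<le> 5" for U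
  proof (rule ccontr)
    assume "\<not> ?thesis"
    then have U2: "2 \<le> card (\<Gamma> \<inter> proj_of U)" and "card (\<Gamma> - proj_of U) < 2 + 2"
      using card_split[OF fin, of "proj_of U"] card by auto
    moreover have "CB_set 2 (\<Gamma> - proj_of U)" using CB_set_excise[OF CB _ U(1)] by simp
    ultimately have "\<Gamma> - proj_of U = {}" using CB_set_empty by blast
    then have "covered 1 4 \<Gamma>"
      using covered_one[of U 4 \<Gamma>] U two_le_dim_of_card[OF U(1) U2] by auto
    then show False using nc covered_mono[of 1 4 \<Gamma> 2 4] by simp
  qed
  have dense: "\<forall>p\<in>\<Gamma>. \<exists>U. vec.subspace U \<and> p \<in> proj_of U \<and>
      (vec.dim U = 2 \<and> 5 \<le> card (\<Gamma> \<inter> proj_of U) \<or> vec.dim U = 3 \<and> 8 \<le> card (\<Gamma> \<inter> proj_of U))"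
  proof
    fix p assume p: "p \<in> \<Gamma>"
    obtain U k where U: "vec.subspace U" "p \<in> proj_of U" "vec.dim U = Suc k" "1 \<le> k"
        "3 * k + 2 \<le> card (\<Gamma> \<inter> proj_of U)"
      using CB_dense_subspace CB p unfolding CB_set_def by metis
    have "card (\<Gamma> \<inter> proj_of U) \<le> card \<Gamma>" using fin by (intro card_mono) auto
    then have "k \<le> 4" using U(5) card by linarith
    moreover have "k \<noteq> 4" using no_hyper[of U] U by auto
    moreover have "k \<noteq> 3" using no_solid[rule_format, of U] U by auto
    ultimately have "k = 1 \<or> k = 2" using U(4) by linarith
    then show "\<exists>U. vec.subspace U \<and> p \<in> proj_of U \<and>
      (vec.dim U = 2 \<and> 5 \<le> card (\<Gamma> \<inter> proj_of U) \<or> vec.dim U = 3 \<and> 8 \<le> card (\<Gamma> \<inter> proj_of U))" using U by auto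
  qed
  show False
  proof (cases "\<exists>P. vec.subspace P \<and> vec.dim P = 3 \<and> 8 \<le> card (\<Gamma> \<inter> proj_of P)")
    case True
    then obtain P where P: "vec.subspace P" "vec.dim P = 3" "8 \<le> card (\<Gamma> \<inter> proj_of P)" by blast
    let ?A = "\<Gamma> - proj_of P"
    have CB_A: "CB_set 2 ?A" using CB_set_excise[OF CB _ P(1)] by simp
    have "\<not> card ?A \<le> 7"
    proof
      assume "card ?A \<le> 7"
      then have cov: "covered 1 2 ?A" using CB_covered_single[OF CB_A, of 2] by simp
      have "covered 2 4 \<Gamma>"
        by (rule covered.plane[where k = 2, OF P(1) _ _ cov]) (use P in auto)
      then show False using nc by blast
    qed
    then have cardA: "card ?A = 8" using card_split[OF fin, of "proj_of P"] P card by linarith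
    have line: "\<exists>N. vec.subspace N \<and> vec.dim N = 2 \<and> p \<in> proj_of N \<and>
        5 \<le> card (\<Gamma> \<inter> proj_of N) \<and> \<Gamma> \<inter> proj_of N \<subseteq> ?A" if p: "p \<in> ?A" for p
    proof -
      obtain N where N: "vec.subspace N" "p \<in> proj_of N"
        "vec.dim N = 2 \<and> 5 \<le> card (\<Gamma> \<inter> proj_of N) \<or> vec.dim N = 3 \<and> 8 \<le> card (\<Gamma> \<inter> proj_of N)"
        using dense p by blast
      have N_P: "\<not> N \<subseteq> P" using N(2) p proj_of_mono by blast
      then have N2: "vec.dim N = 2" "5 \<le> card (\<Gamma> \<inter> proj_of N)"
        using CB_3_rich_plane_unique[OF CB card nc no_solid dense P N(1)] N(3) by auto
      have dim: "vec.dim (P \<inter> N) < 2" using dim_Int_less[OF P(1) N(1) N_P] N2 by simp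
      have "\<Gamma> \<inter> proj_of N \<inter> proj_of P = {}"
      proof (rule ccontr)
        assume "\<not> ?thesis"
        then obtain q where "q \<in> proj_of (P \<inter> N)" by (auto simp: proj_of_Int)
        then have "1 \<le> vec.dim (P \<inter> N)"
          using vec.dim_subset[of q "P \<inter> N"] by (simp add: proj_of_def proj_space_def)
        then have "vec.dim (vec.span (P \<union> N)) \<le> 4"
          using dim_span_Un[OF P(1) N(1)] P N2 by simp
        then have "card (\<Gamma> \<inter> proj_of (vec.span (P \<union> N))) \<le> 10" using no_solid by simp
        moreover have "card (\<Gamma> \<inter> proj_of (P \<inter> N)) \<le> 1"
          using dim P N by (intro card_Int_proj_of_le_1 vec.subspace_inter)
        ultimately show False using card_join[OF fin, of P N] P N2 by linarith
      qed
      then show ?thesis using N N2 by blast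
    qed
    have "?A \<noteq> {}" using cardA by (metis card.empty zero_neq_numeral)
    then obtain p1 where "p1 \<in> ?A" by blast
    then obtain N1 where N1: "vec.subspace N1" "vec.dim N1 = 2" "5 \<le> card (\<Gamma> \<inter> proj_of N1)"
        "\<Gamma> \<inter> proj_of N1 \<subseteq> ?A" using line by blast
    have "?A - proj_of N1 \<noteq> {}"
    proof
      assume "?A - proj_of N1 = {}"
      then have "covered 2 4 \<Gamma>" using covered_two[of P N1 4 \<Gamma>] P N1 by auto
      then show False using nc by blast
    qed
    then obtain p2 where p2: "p2 \<in> ?A" "p2 \<notin> proj_of N1" by blast
    then obtain N2 where N2: "vec.subspace N2" "vec.dim N2 = 2" "p2 \<in> proj_of N2"
        "5 \<le> card (\<Gamma> \<inter> proj_of N2)" "\<Gamma> \<inter> proj_of N2 \<subseteq> ?A" using line by blast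
    have "\<not> N2 \<subseteq> N1" using p2 N2(3) proj_of_mono by blast
    then have "card (\<Gamma> \<inter> proj_of (N1 \<inter> N2)) \<le> 1"
      using dim_Int_less[OF N1(1) N2(1)] N1 N2 by (intro card_Int_proj_of_le_1 vec.subspace_inter) auto
    moreover have "card (\<Gamma> \<inter> proj_of N1) + card (\<Gamma> \<inter> proj_of N2) =
        card (\<Gamma> \<inter> proj_of N1 \<union> \<Gamma> \<inter> proj_of N2) + card (\<Gamma> \<inter> proj_of (N1 \<inter> N2))"
      using card_Un_Int[of "\<Gamma> \<inter> proj_of N1" "\<Gamma> \<inter> proj_of N2"] fin by (simp add: proj_of_Int Int_ac)
    moreover have "card (\<Gamma> \<inter> proj_of N1 \<union> \<Gamma> \<inter> proj_of N2) \<le> card ?A"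
      using N1 N2 fin by (intro card_mono) auto
    ultimately show False using N1 N2 cardA by linarith
  next
    case False
    have line: "\<forall>p\<in>\<Gamma>. \<exists>L. vec.subspace L \<and> vec.dim L = 2 \<and> p \<in> proj_of L \<and>
        3 + 2 \<le> card (\<Gamma> \<inter> proj_of L)"
      using dense False by fastforce
    have no_plane: "\<forall>U. vec.subspace U \<and> vec.dim U = 3 \<longrightarrow> card (\<Gamma> \<inter> proj_of U) < 2 * 3 + 2"
      using False by (auto simp: not_le)
    have "3 \<le> (3::nat)" "\<Gamma> \<noteq> {}" "card \<Gamma> \<le> 4 * 3 + 4"
      using nc card covered.empty by auto
    from CB this line no_plane show False
    proof (cases rule: CB_lines)
      case (two L M)
      then show ?thesis using covered_two[of L M 4 \<Gamma>] nc by simp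
    next
      case (three L M N)
      \<comment> \<open>Replacing two of the lines by their span keeps the total dimension and saves one subspace.\<close>
      let ?J = "vec.span (M \<union> N)"
      have "vec.dim ?J \<le> 4" using dim_span_Un[of M N] three by simp
      moreover have "2 \<le> vec.dim ?J"
        using vec.dim_subset[of M "M \<union> N"] three by simp
      moreover have "proj_of M \<union> proj_of N \<subseteq> proj_of ?J"
        using vec.span_superset[of "M \<union> N"] by (auto simp: proj_of_def)
      ultimately have "covered 2 4 \<Gamma>" using covered_two[of L ?J 4 \<Gamma>] three by auto
      then show ?thesis using nc by blast
    qed
  qed
qed

theorem theorem1p3:
  fixes n r d :: nat
    and \<Gamma> :: "('a::alg_closed_field ^ 'v::finite) set set"
  assumes "CARD('v) = n + 1"
    and "\<Gamma> \<subseteq> proj_space"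
    and "finite \<Gamma>"
    and "CB r \<Gamma>"
    and "card \<Gamma> \<le> (d + 1) * r + 1"
  shows
    "(r \<le> 2 \<longrightarrow>
       (\<exists>\<P>. plane_config \<P> \<and> lies_on \<Gamma> \<P> \<and> config_dim \<P> \<le> d \<and> config_length \<P> \<le> 1))
   \<and> (d \<le> 3 \<longrightarrow>
       (\<exists>\<P>. plane_config \<P> \<and> lies_on \<Gamma> \<P> \<and> config_dim \<P> \<le> d)
     \<and> (r \<le> 4 \<longrightarrow>
         (\<exists>\<P>. plane_config \<P> \<and> lies_on \<Gamma> \<P> \<and> config_dim \<P> \<le> d \<and> config_length \<P> \<le> 2)))
   \<and> (d = 4 \<and> r = 3 \<longrightarrow>
       (\<exists>\<P>. plane_config \<P> \<and> lies_on \<Gamma> \<P> \<and> config_dim \<P> \<le> 4 \<and> config_length \<P> \<le> 2))"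
proof -
  have CB: "CB_set r \<Gamma>" using assms by (simp add: CB_set_def)
  have "covered 1 d \<Gamma>" if "r \<le> 2" using CB_covered_single[OF CB that assms(5)] .
  moreover have "covered (if r \<le> 4 then 2 else 3) d \<Gamma>" if d: "d \<le> 3"
  proof -
    consider "d = 0" | "d = 1" | "d = 2" | "d = 3" using d by linarith
    then show ?thesis
    proof cases
      case 1
      then have "\<Gamma> = {}" using CB_set_empty[OF CB] assms(5) by simp
      then show ?thesis by (simp add: covered.empty)
    next
      case 2
      then have "covered 1 1 \<Gamma>" using CB_covered_line[OF CB] assms(5) by simp
      then show ?thesis by (rule covered_mono) (use 2 in auto)
    next
      case 3
      then have "covered 2 2 \<Gamma>" using CB_covered_dim_2[OF CB] assms(5) by simp
      then show ?thesis by (rule covered_mono) (use 3 in auto)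
    next
      case 4
      then show ?thesis using CB_covered_dim_3[OF CB] assms(5) by simp
    qed
  qed
  moreover have "covered 2 4 \<Gamma>" if "d = 4 \<and> r = 3"
    using CB_3_covered_dim_4[of \<Gamma>] CB assms(5) that by simp
  moreover have "covered 2 d \<Gamma>" if "d \<le> 3" "r \<le> 4"
    using calculation(2)[OF that(1)] that(2) by simp
  ultimately show ?thesis
    by (blast dest: covered_imp_plane_config)
qed

end
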